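(* For all integers $i,j\ge0$, $$E_iE_j=q^{\kappa ij}E_{i+j}.$$ The multiplier $\omega_{q,\kappa}(i,j)=q^{\kappa ij}$ is normalized, that is, $\omega_{q,\kappa}(0,j)=\omega_{q,\kappa}(i,0)=1$, and satisfies for all integers $i,j,k\ge0$ $$\omega_{q,\kappa}(i,j)\,\omega_{q,\kappa}(i+j,k)=\omega_{q,\kappa}(j,k)\,\omega_{q,\kappa}(i,j+k).$$ Thus the additive monoid law on $\mathbb N_0$ is represented by $\{E_n\}_{n\ge0}$ up to the scalar multiplier $\omega_{q,\kappa}$.
   Context: Let $\mathcal X$ be a complex linear space and $\{U_t\}_{t\in\mathbb R}$ a representation of $(\mathbb R,+)$ on $\mathcal X$ by invertible linear operators. Let $\mathcal D\subset\mathcal X$ be a linear subspace invariant under every $U_t$, and let $M:\mathcal D\to\mathcal D$ be a linear operator such that, on $\mathcal D$, $U_tMU_{-t}=e^{\kappa t}M$ for all $t\in\mathbb R$, for some fixed $\kappa\in\mathbb C$. Fix a real $h\neq0$, put $q=e^h>0$ and $T_q=U_h$ (restricted to $\mathcal D$), and use the convention $q^{\kappa c}=e^{\kappa ch}$ for integers $c$. For $n\ge0$ set $E_n=M^nT_q^n$, an operator on $\mathcal D$. *)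

theory Defs
  imports Complex_Main
begin

definition linear_operator_on ::
    "(complex \<Rightarrow> 'a \<Rightarrow> 'a) \<Rightarrow> 'a set \<Rightarrow> ('a::ab_group_add \<Rightarrow> 'a) \<Rightarrow> bool" where
  \<comment> \<open>An operator on \<open>D\<close> is encoded by a total function whose values outside \<open>D\<close> are irrelevant;
     accordingly, identities between operators on \<open>D\<close> are stated pointwise on \<open>D\<close>.\<close>
  "linear_operator_on scale D A \<longleftrightarrow>
     (\<forall>x\<in>D. A x \<in> D) \<and>
     (\<forall>x\<in>D. \<forall>y\<in>D. A (x + y) = A x + A y) \<and>
     (\<forall>c. \<forall>x\<in>D. A (scale c x) = scale c (A x))"

definition real_representation ::
    "(complex \<Rightarrow> 'a \<Rightarrow> 'a) \<Rightarrow> (real \<Rightarrow> 'a::ab_group_add \<Rightarrow> 'a) \<Rightarrow> bool" where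
  "real_representation scale U \<longleftrightarrow>
     (\<forall>t. Vector_Spaces.linear scale scale (U t) \<and> bij (U t)) \<and>
     U 0 = id \<and> (\<forall>s t. U (s + t) = U s \<circ> U t)"

definition q_power :: "real \<Rightarrow> complex \<Rightarrow> int \<Rightarrow> complex" where
  \<comment> \<open>The value \<open>q\<^sup>\<kappa>\<^sup>c\<close> for \<open>q = exp h\<close>. Since \<open>h\<close> is the real logarithm of \<open>q\<close>, the objects
     indexed by \<open>q\<close> are indexed by \<open>h\<close> here and below.\<close>
  "q_power h \<kappa> c = exp (\<kappa> * of_int c * of_real h)"

definition omega :: "real \<Rightarrow> complex \<Rightarrow> nat \<Rightarrow> nat \<Rightarrow> complex" where
  "omega h \<kappa> i j = q_power h \<kappa> (int i * int j)"

definition E_op :: "('a \<Rightarrow> 'a) \<Rightarrow> (real \<Rightarrow> 'a \<Rightarrow> 'a) \<Rightarrow> real \<Rightarrow> nat \<Rightarrow> 'a \<Rightarrow> 'a" where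
  "E_op M U h n = (M ^^ n) \<circ> ((U h) ^^ n)"

definition normalized_multiplier :: "(nat \<Rightarrow> nat \<Rightarrow> complex) \<Rightarrow> bool" where
  "normalized_multiplier w \<longleftrightarrow> (\<forall>i j. w 0 j = 1 \<and> w i 0 = 1)"

definition multiplier_cocycle :: "(nat \<Rightarrow> nat \<Rightarrow> complex) \<Rightarrow> bool" where
  "multiplier_cocycle w \<longleftrightarrow> (\<forall>i j k. w i j * w (i + j) k = w j k * w i (j + k))"

text \<open>A representation of the additive monoid of natural numbers by linear operators on \<open>D\<close>,
  up to the nonzero scalars \<open>w i j\<close>.\<close>

definition represents_nat_up_to_multiplier ::
    "(complex \<Rightarrow> 'a \<Rightarrow> 'a) \<Rightarrow> 'a set \<Rightarrow> (nat \<Rightarrow> 'a::ab_group_add \<Rightarrow> 'a)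
      \<Rightarrow> (nat \<Rightarrow> nat \<Rightarrow> complex) \<Rightarrow> bool" where
  "represents_nat_up_to_multiplier scale D E w \<longleftrightarrow>
     (\<forall>n. linear_operator_on scale D (E n)) \<and>
     (\<forall>i j. w i j \<noteq> 0) \<and> normalized_multiplier w \<and> multiplier_cocycle w \<and>
     (\<forall>x\<in>D. E 0 x = x) \<and>
     (\<forall>i j. \<forall>x\<in>D. (E i \<circ> E j) x = scale (w i j) (E (i + j) x))"

end

theory Submission imports Defs begin

text \<open>
  Write \<open>T\<close> for \<open>U h\<close> and \<open>\<lambda>\<close> for \<open>exp (\<kappa> * h)\<close>. The covariance \<open>U t M U (- t) = exp (\<kappa> * t) M\<close> at
  \<open>t = h\<close>, applied to vectors \<open>T x\<close>, says that \<open>T M = \<lambda> M T\<close> on \<open>D\<close>. So moving one \<open>T\<close> to the right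
  past one \<open>M\<close> costs one factor \<open>\<lambda>\<close>, and moving \<open>i\<close> copies of \<open>T\<close> past \<open>j\<close> copies of \<open>M\<close> costs
  \<open>\<lambda> ^ (i * j)\<close> (lemma \<open>funpow_q_commute\<close>). In \<open>M\<^sup>i T\<^sup>i M\<^sup>j T\<^sup>j\<close> exactly this exchange has to be made
  in the middle to reach \<open>M\<^bsup>i+j\<^esup> T\<^bsup>i+j\<^esup>\<close>, which is the product formula.

  The multiplier is therefore \<open>\<lambda> ^ (i * j)\<close> (lemma \<open>omega_eq_power\<close>), a bimultiplicative function of
  \<open>(i, j)\<close>. Normalization and the cocycle identity express that \<open>i * j\<close> is biadditive: it vanishes
  when an argument does, and \<open>i * j + (i + j) * k = j * k + i * (j + k)\<close>.
\<close>

lemma linear_operator_on_compose: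
  assumes "linear_operator_on scale D A" "linear_operator_on scale D B"
  shows "linear_operator_on scale D (A \<circ> B)"
  using assms by (simp add: linear_operator_on_def)

lemma linear_operator_on_funpow:
  assumes "linear_operator_on scale D A"
  shows "linear_operator_on scale D (A ^^ n)"
proof (induction n)
  case 0
  show ?case by (simp add: linear_operator_on_def)
next
  case (Suc n)
  show ?case
    using linear_operator_on_compose[OF assms Suc.IH] by (simp only: funpow.simps)
qed

lemma linear_operator_on_restrict:
  assumes "Vector_Spaces.linear scale scale A" "A ` D \<subseteq> D"
  shows "linear_operator_on scale D A"
proof -
  interpret Vector_Spaces.linear scale scale A by fact
  show ?thesis
    using assms(2) by (auto simp: linear_operator_on_def add scale)
qed

text \<open>Two nested inductions on the number of exchanges: \<open>T\<close> is first moved past all factors \<open>M\<close>, and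
  then the copies of \<open>T\<close> are moved one after the other, innermost first.\<close>

lemma funpow_q_commute:
  assumes vs: "vector_space scale"
    and M: "linear_operator_on scale D M"
    and T: "linear_operator_on scale D T"
    and comm: "\<And>x. x \<in> D \<Longrightarrow> T (M x) = scale l (M (T x))"
    and x: "x \<in> D"
  shows "(T ^^ i) ((M ^^ j) x) = scale (l ^ (i * j)) ((M ^^ j) ((T ^^ i) x))"
proof -
  interpret vector_space scale by (fact vs)
  have Mpow: "(M ^^ n) y \<in> D" and Tpow: "(T ^^ n) y \<in> D" if "y \<in> D" for n y
    using linear_operator_on_funpow[OF M, of n] linear_operator_on_funpow[OF T, of n] that
    by (auto simp: linear_operator_on_def)
  have T_in: "T y \<in> D" if "y \<in> D" for y
    using T that by (simp add: linear_operator_on_def)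
  have one: "T ((M ^^ j) y) = scale (l ^ j) ((M ^^ j) (T y))" if y: "y \<in> D" for y
  proof (induction j)
    case 0
    show ?case by simp
  next
    case (Suc j)
    have "T ((M ^^ Suc j) y) = scale l (M (T ((M ^^ j) y)))"
      using comm[OF Mpow[OF y]] by simp
    also have "\<dots> = scale l (M (scale (l ^ j) ((M ^^ j) (T y))))"
      by (simp only: Suc.IH)
    also have "\<dots> = scale (l ^ Suc j) ((M ^^ Suc j) (T y))"
      using M Mpow[OF T_in[OF y]] by (simp add: linear_operator_on_def)
    finally show ?case .
  qed
  show ?thesis
  proof (induction i)
    case 0
    show ?case by simp
  next
    case (Suc i)
    have "(T ^^ Suc i) ((M ^^ j) x) = T (scale (l ^ (i * j)) ((M ^^ j) ((T ^^ i) x)))"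
      by (simp add: Suc.IH)
    also have "\<dots> = scale (l ^ (i * j)) (T ((M ^^ j) ((T ^^ i) x)))"
      using T Mpow[OF Tpow[OF x]] by (simp add: linear_operator_on_def)
    also have "\<dots> = scale (l ^ (Suc i * j)) ((M ^^ j) ((T ^^ Suc i) x))"
      using one[OF Tpow[OF x]] by (simp add: power_add mult.commute)
    finally show ?case .
  qed
qed

lemma omega_eq_power: "omega h \<kappa> i j = exp (\<kappa> * of_real h) ^ (i * j)"
proof -
  have "\<kappa> * of_int (int i * int j) * of_real h = of_nat (i * j) * (\<kappa> * of_real h)"
    by simp
  then show ?thesis
    by (simp only: omega_def q_power_def exp_of_nat_mult)
qed

lemma normalized_multiplier_omega: "normalized_multiplier (omega h \<kappa>)"
  by (simp add: normalized_multiplier_def omega_eq_power)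

lemma multiplier_cocycle_omega: "multiplier_cocycle (omega h \<kappa>)"
  by (simp add: multiplier_cocycle_def omega_eq_power power_add[symmetric] algebra_simps)

theorem proposition2p2:
  fixes scale :: "complex \<Rightarrow> 'a::ab_group_add \<Rightarrow> 'a"
    and U :: "real \<Rightarrow> 'a \<Rightarrow> 'a"
    and D :: "'a set"
    and M :: "'a \<Rightarrow> 'a"
    and \<kappa> :: complex
    and h :: real
  assumes "vector_space scale"
    and "real_representation scale U"
    and "module.subspace scale D"
    and "\<And>t. U t ` D \<subseteq> D"
    and "linear_operator_on scale D M"
    and "\<And>t x. x \<in> D \<Longrightarrow> U t (M (U (- t) x)) = scale (exp (\<kappa> * of_real t)) (M x)"
    and "h \<noteq> 0"
  shows "(\<forall>i j. \<forall>x\<in>D. (E_op M U h i \<circ> E_op M U h j) x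
             = scale (q_power h \<kappa> (int i * int j)) (E_op M U h (i + j) x))
    \<and> (\<forall>i j. omega h \<kappa> 0 j = 1 \<and> omega h \<kappa> i 0 = 1)
    \<and> (\<forall>i j k. omega h \<kappa> i j * omega h \<kappa> (i + j) k = omega h \<kappa> j k * omega h \<kappa> i (j + k))
    \<and> represents_nat_up_to_multiplier scale D (E_op M U h) (omega h \<kappa>)"
proof -
  interpret vector_space scale by (fact assms(1))
  have U_lin: "Vector_Spaces.linear scale scale (U h)"
    and U_zero: "U 0 = id" and U_add: "\<And>s t. U (s + t) = U s \<circ> U t"
    using assms(2) by (auto simp: real_representation_def)
  have T: "linear_operator_on scale D (U h)"
    using U_lin assms(4) by (rule linear_operator_on_restrict)
  note M = assms(5)
  have T_in: "(U h ^^ n) x \<in> D" if "x \<in> D" for n x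
    using linear_operator_on_funpow[OF T, of n] that by (simp add: linear_operator_on_def)
  have M_in: "(M ^^ n) x \<in> D" if "x \<in> D" for n x
    using linear_operator_on_funpow[OF M, of n] that by (simp add: linear_operator_on_def)
  have comm: "U h (M x) = scale (exp (\<kappa> * of_real h)) (M (U h x))" if x: "x \<in> D" for x
  proof -
    have "U (- h) (U h x) = x"
      using U_add[of "- h" h] U_zero by (metis add.left_inverse comp_apply id_apply)
    moreover have "U h x \<in> D"
      using assms(4) x by blast
    ultimately show ?thesis
      using assms(6)[of "U h x" h] by simp
  qed
  have product: "(E_op M U h i \<circ> E_op M U h j) x = scale (omega h \<kappa> i j) (E_op M U h (i + j) x)"
    if x: "x \<in> D" for i j x
  proof -
    have "(E_op M U h i \<circ> E_op M U h j) x = (M ^^ i) ((U h ^^ i) ((M ^^ j) ((U h ^^ j) x)))"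
      by (simp add: E_op_def)
    also have "\<dots> = (M ^^ i) (scale (omega h \<kappa> i j) ((M ^^ j) ((U h ^^ i) ((U h ^^ j) x))))"
      using funpow_q_commute[OF assms(1) M T comm T_in[OF x]] by (simp add: omega_eq_power)
    also have "\<dots> = scale (omega h \<kappa> i j) ((M ^^ i) ((M ^^ j) ((U h ^^ i) ((U h ^^ j) x))))"
      using linear_operator_on_funpow[OF M, of i] M_in[OF T_in[OF T_in[OF x]]]
      by (simp add: linear_operator_on_def)
    also have "\<dots> = scale (omega h \<kappa> i j) (E_op M U h (i + j) x)"
      by (simp add: E_op_def funpow_add)
    finally show ?thesis .
  qed
  have E_lin: "linear_operator_on scale D (E_op M U h n)" for n
    unfolding E_op_def
    by (intro linear_operator_on_compose linear_operator_on_funpow M T)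
  have "represents_nat_up_to_multiplier scale D (E_op M U h) (omega h \<kappa>)"
    unfolding represents_nat_up_to_multiplier_def
    using E_lin product normalized_multiplier_omega multiplier_cocycle_omega
    by (auto simp: omega_eq_power E_op_def)
  then show ?thesis
    using product normalized_multiplier_omega[of h \<kappa>] multiplier_cocycle_omega[of h \<kappa>]
    by (simp add: omega_def normalized_multiplier_def multiplier_cocycle_def)
qed

end
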